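(* Let $a_n = E(\det(G_n))$, $p_n = E(\operatorname{perm}(G_n))$ and $t_n = \operatorname{trace}(M^n)$, where $G_n$ is the random Gram matrix of size $n$ and $M$ is the $t\times t$ matrix of second moments of the underlying random vector $w$. Then, as identities of formal power series in $x$, $$\sum_{n=0}^{\infty} a_n \frac{x^n}{n!} = \exp\left\{ \frac{t_1 x}{1} - \frac{t_2 x^2}{2} + \frac{t_3 x^3}{3} - \cdots \right\} = \exp\left\{\sum_{k\ge 1} (-1)^{k-1}\frac{t_k x^k}{k}\right\}$$ and $$\sum_{n=0}^{\infty} p_n \frac{x^n}{n!} = \exp\left\{ \frac{t_1 x}{1} + \frac{t_2 x^2}{2} + \frac{t_3 x^3}{3} + \cdots \right\} = \exp\left\{\sum_{k\ge 1} \frac{t_k x^k}{k}\right\}.$$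
   Context: Let $t\ge 1$ be an integer and let $w=(w_1,\dots,w_t)^T$ be a random vector whose components are real random variables (not necessarily independent or identically distributed), with all second moments $E(w_iw_j)$ finite. The matrix of second moments is the $t\times t$ matrix $M$ with $M_{ij}=E(w_iw_j)$, $1\le i,j\le t$. For each $n\ge 0$, let $w^{(1)},\dots,w^{(n)}$ be $n$ independent random vectors, each with the same distribution as $w$; let $A$ be the $t\times n$ matrix with columns $w^{(1)},\dots,w^{(n)}$. The random Gram matrix of size $n$ is the $n\times n$ matrix $G_n=A^TA$, so that $(G_n)_{ij}=w^{(i)}\cdot w^{(j)}$. $E$ denotes expectation, and $\operatorname{perm}(B)=\sum_{\sigma\in S_n}\prod_{i=1}^n B_{i,\sigma(i)}$ is the permanent of an $n\times n$ matrix $B$. By convention the determinant and permanent of the $0\times 0$ matrix equal $1$, so $a_0=p_0=1$. *)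

theory Defs
  imports "HOL-Probability.Probability" "HOL-Computational_Algebra.Formal_Power_Series"
    "Jordan_Normal_Form.Determinant"
begin

(* Vectors in R^t are functions on {..<t}, extended by undefined, as in the library's product
   measures; indices run from 0. *)
abbreviation real_space :: "nat \<Rightarrow> (nat \<Rightarrow> real) measure" where
  "real_space t \<equiv> Pi\<^sub>M {..<t} (\<lambda>_. borel)"

definition second_moment_mat :: "'a measure \<Rightarrow> nat \<Rightarrow> ('a \<Rightarrow> nat \<Rightarrow> real) \<Rightarrow> real mat" where
  "second_moment_mat P t w = Matrix.mat t t (\<lambda>(i, j). \<integral>\<omega>. w \<omega> i * w \<omega> j \<partial>P)"

definition columns_mat :: "nat \<Rightarrow> nat \<Rightarrow> (nat \<Rightarrow> nat \<Rightarrow> real) \<Rightarrow> real mat" where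
  "columns_mat t n v = Matrix.mat t n (\<lambda>(k, i). v i k)"

definition gram_mat :: "nat \<Rightarrow> nat \<Rightarrow> (nat \<Rightarrow> nat \<Rightarrow> real) \<Rightarrow> real mat" where
  "gram_mat t n v = transpose_mat (columns_mat t n v) * columns_mat t n v"

lemma gram_mat_carrier: "gram_mat t n v \<in> carrier_mat n n"
proof (rule carrier_matI)
  show "dim_row (gram_mat t n v) = n" "dim_col (gram_mat t n v) = n"
    unfolding gram_mat_def columns_mat_def by simp_all
qed

lemma gram_mat_index:
  assumes "i < n" "j < n"
  shows "gram_mat t n v $$ (i, j) = (\<Sum>k<t. v i k * v j k)"
  using assms unfolding gram_mat_def columns_mat_def
  by (simp add: scalar_prod_def atLeast0LessThan)

(* Used for square matrices only. *)
definition permanent :: "'a::comm_ring_1 mat \<Rightarrow> 'a" where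
  "permanent B =
     (\<Sum>\<sigma> | \<sigma> permutes {0..<dim_row B}. \<Prod>i = 0..<dim_row B. B $$ (i, \<sigma> i))"

definition mat_trace :: "'a::comm_ring_1 mat \<Rightarrow> 'a" where
  "mat_trace B = (\<Sum>i = 0..<dim_row B. B $$ (i, i))"

end

theory Submission
  imports Defs
begin

text \<open>Expanding the \<open>(i, j)\<close> entry of the Gram matrix as \<open>\<Sum>l<t. w\<^sup>i\<^sub>l w\<^sup>j\<^sub>l\<close>, the product
  of the entries \<open>(i, \<sigma> i)\<close> becomes a sum over labellings \<open>k\<close> of \<open>{0..<n}\<close> by coordinates.
  In each summand every random vector contributes exactly two of its components, one for the
  factor that leaves \<open>i\<close> and one for the factor that enters it. Independence therefore
  replaces the summand by a product of second moments \<open>M (k i, k (\<sigma> i))\<close>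
  (lemma \<open>expectation_gram_permutation_product\<close>). Second moments suffice, although the product
  of Gram entries has degree \<open>2n\<close>.

  For a fixed permutation, the sum over all labellings factors over the cycles, and a cycle of
  length \<open>m\<close> contributes the closed walk sum \<open>trace (M\<^sup>m)\<close>. Since there are \<open>(m - 1)!\<close> cycles on
  \<open>m\<close> points, each cycle having sign \<open>(-1)\<^sup>m\<^sup>-\<^sup>1\<close>, the claim is an instance of the exponential
  formula.

  Cycle types need not be counted, because the exponential satisfies \<open>E' = S' E\<close>, which is a
  recursion for its coefficients. The permutation sums obey the same recursion: it arises by
  removing a point \<open>a\<close> from its cycle. If \<open>a\<close> is fixed, it contributes the trace of the matrix
  at \<open>a\<close>. If \<open>a\<close> is preceded by \<open>b\<close>, the sum over the label of \<open>a\<close> multiplies the matrix at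
  \<open>b\<close> by the one at \<open>a\<close>, and one point is gone (lemma \<open>permutation_walk_sum_insert\<close>). Repeated
  removal collects the powers of \<open>M\<close> at a single point until its cycle closes, which yields the
  recursion (lemma \<open>permutation_walk_sum_trace_recursion\<close>). The sign enters only through the
  factor \<open>\<epsilon>\<close> by which each merging step changes the weight of the permutation, so determinant
  (\<open>\<epsilon> = -1\<close>) and permanent (\<open>\<epsilon> = 1\<close>) are treated together.\<close>

section \<open>Permutation sums and removal of a point\<close>

text \<open>The point \<open>a\<close> is fixed by \<open>q\<close>, and \<open>q \<circ> transpose a b\<close> inserts it into the cycle of \<open>b\<close>.
  On permutations of finite sets the condition thus determines \<open>\<gamma>\<close>: it is \<open>\<epsilon>\<close> to the number of
  points minus the number of cycles, which is the sign for \<open>\<epsilon> = -1\<close>.\<close>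
definition cycle_insertion_weight :: "'r::comm_ring_1 \<Rightarrow> (('i \<Rightarrow> 'i) \<Rightarrow> 'r) \<Rightarrow> bool" where
  "cycle_insertion_weight \<epsilon> \<gamma> \<longleftrightarrow> \<gamma> id = 1 \<and>
     (\<forall>S q a b. finite S \<longrightarrow> q permutes S \<longrightarrow> a \<notin> S \<longrightarrow> b \<in> S \<longrightarrow>
       \<gamma> (q \<circ> Transposition.transpose a b) = \<epsilon> * \<gamma> q)"

text \<open>With all \<open>B i\<close> equal, this is a weighted sum, over the permutations, of products of traces
  of powers, one factor per cycle. The matrix is allowed to vary with the point because merging
  two steps of a cycle changes the matrix at one point only.\<close>
definition permutation_walk_sum ::
  "(('i \<Rightarrow> 'i) \<Rightarrow> 'r::comm_ring_1) \<Rightarrow> nat \<Rightarrow> ('i \<Rightarrow> 'r mat) \<Rightarrow> 'i set \<Rightarrow> 'r" where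
  "permutation_walk_sum \<gamma> t B S =
     (\<Sum>\<sigma> | \<sigma> permutes S. \<gamma> \<sigma> * (\<Sum>k\<in>S \<rightarrow>\<^sub>E {..<t}. \<Prod>i\<in>S. B i $$ (k i, k (\<sigma> i))))"

lemma cycle_insertion_weight_sign:
  "cycle_insertion_weight (-1) (\<lambda>\<sigma>. of_int (sign \<sigma>) :: 'r::comm_ring_1)"
  unfolding cycle_insertion_weight_def
  by (auto simp: sign_compose sign_swap_id permutes_imp_permutation permutation_swap_id)

lemma cycle_insertion_weight_one: "cycle_insertion_weight 1 (\<lambda>_. 1 :: 'r::comm_ring_1)"
  unfolding cycle_insertion_weight_def by simp

text \<open>The mirror image of \<open>sum_over_permutations_insert\<close>, with the transposition on the right.
  In \<open>q \<circ> transpose a b\<close> the new point \<open>a\<close> sits between \<open>b\<close> and \<open>q b\<close>, so that the matrix at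
  the departure point \<open>b\<close> is the one that absorbs the matrix at \<open>a\<close>.\<close>
lemma sum_permutes_insert_right:
  assumes "finite S" "a \<notin> S"
  shows "(\<Sum>\<sigma> | \<sigma> permutes insert a S. f \<sigma>) =
         (\<Sum>b\<in>insert a S. \<Sum>q | q permutes S. f (q \<circ> Transposition.transpose a b))"
proof -
  have "(\<Sum>\<sigma> | \<sigma> permutes insert a S. f \<sigma>) =
        (\<Sum>b\<in>insert a S. \<Sum>q | q permutes S. f (Hilbert_Choice.inv (Transposition.transpose a b \<circ> q)))"
    by (subst sum_permutations_inverse) (rule sum_over_permutations_insert[OF assms])
  also have "\<dots> = (\<Sum>b\<in>insert a S. \<Sum>q | q permutes S. f (Hilbert_Choice.inv q \<circ> Transposition.transpose a b))"
    by (intro sum.cong refl) (simp add: o_inv_distrib permutes_bij)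
  also have "\<dots> = (\<Sum>b\<in>insert a S. \<Sum>q | q permutes S. f (q \<circ> Transposition.transpose a b))"
    by (intro sum.cong refl sum_permutations_inverse[symmetric])
  finally show ?thesis .
qed

lemma sum_PiE_insert:
  assumes "a \<notin> S"
  shows "(\<Sum>k\<in>insert a S \<rightarrow>\<^sub>E K. f k) = (\<Sum>k\<in>S \<rightarrow>\<^sub>E K. \<Sum>x\<in>K. f (k(a := x)))"
proof -
  have "(\<Sum>k\<in>insert a S \<rightarrow>\<^sub>E K. f k) = (\<Sum>(x, k)\<in>K \<times> (S \<rightarrow>\<^sub>E K). f (k(a := x)))"
    unfolding PiE_insert_eq
    by (subst sum.reindex[OF inj_combinator[OF assms]]) (simp add: case_prod_unfold)
  also have "\<dots> = (\<Sum>x\<in>K. \<Sum>k\<in>S \<rightarrow>\<^sub>E K. f (k(a := x)))"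
    by (simp add: sum.cartesian_product)
  finally show ?thesis
    by (subst (asm) sum.swap)
qed

lemma permutation_walk_sum_cong:
  assumes "\<And>i. i \<in> S \<Longrightarrow> B i = C i"
  shows "permutation_walk_sum \<gamma> t B S = permutation_walk_sum \<gamma> t C S"
  unfolding permutation_walk_sum_def using assms by (auto intro!: sum.cong prod.cong)

text \<open>A permutation of \<open>insert a S\<close> either fixes \<open>a\<close> or arises from a permutation of \<open>S\<close> by
  inserting \<open>a\<close> directly after some \<open>b\<close>. In the first case the label of \<open>a\<close> occurs only in a
  diagonal entry. In the second case it occurs only in the two steps \<open>b \<longrightarrow> a \<longrightarrow> q b\<close>, and the sum
  over it is an entry of \<open>B b * B a\<close>.\<close>
lemma permutation_walk_sum_insert:
  fixes B :: "'i \<Rightarrow> 'r::comm_ring_1 mat"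
  assumes \<gamma>: "cycle_insertion_weight \<epsilon> \<gamma>"
    and S: "finite S" "a \<notin> S"
    and B: "\<And>i. i \<in> insert a S \<Longrightarrow> B i \<in> carrier_mat t t"
  shows "permutation_walk_sum \<gamma> t B (insert a S) =
           mat_trace (B a) * permutation_walk_sum \<gamma> t B S
           + \<epsilon> * (\<Sum>b\<in>S. permutation_walk_sum \<gamma> t (B(b := B b * B a)) S)"
proof -
  let ?K = "{..<t}"
  define F where "F \<sigma> = \<gamma> \<sigma> * (\<Sum>k\<in>insert a S \<rightarrow>\<^sub>E ?K. \<Prod>i\<in>insert a S. B i $$ (k i, k (\<sigma> i)))" for \<sigma>
  have fixed: "F q = mat_trace (B a) * (\<gamma> q * (\<Sum>k\<in>S \<rightarrow>\<^sub>E ?K. \<Prod>i\<in>S. B i $$ (k i, k (q i))))"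
    if q: "q permutes S" for q
  proof -
    have qa: "q a = a" using q S by (simp add: permutes_not_in)
    have qS: "q i \<noteq> a" if "i \<in> S" for i using q S that permutes_in_image[OF q] by metis
    have "(\<Sum>k\<in>insert a S \<rightarrow>\<^sub>E ?K. \<Prod>i\<in>insert a S. B i $$ (k i, k (q i))) =
      (\<Sum>k\<in>S \<rightarrow>\<^sub>E ?K. \<Sum>x\<in>?K. B a $$ (x, x) * (\<Prod>i\<in>S. B i $$ (k i, k (q i))))"
      unfolding sum_PiE_insert[OF S(2)]
    proof (intro sum.cong refl)
      fix k :: "'i \<Rightarrow> nat" and x
      have "(\<Prod>i\<in>S. B i $$ ((k(a := x)) i, (k(a := x)) (q i))) = (\<Prod>i\<in>S. B i $$ (k i, k (q i)))"
        using S qS by (intro prod.cong) auto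
      then show "(\<Prod>i\<in>insert a S. B i $$ ((k(a := x)) i, (k(a := x)) (q i))) =
        B a $$ (x, x) * (\<Prod>i\<in>S. B i $$ (k i, k (q i)))"
        by (subst prod.insert[OF S]) (simp only: qa fun_upd_same)
    qed
    also have "\<dots> = mat_trace (B a) * (\<Sum>k\<in>S \<rightarrow>\<^sub>E ?K. \<Prod>i\<in>S. B i $$ (k i, k (q i)))"
      using B[of a] by (simp add: mat_trace_def atLeast0LessThan sum_distrib_left sum_distrib_right)
    finally show ?thesis by (simp add: F_def mult_ac)
  qed
  have spliced: "F (q \<circ> Transposition.transpose a b) =
      \<epsilon> * (\<gamma> q * (\<Sum>k\<in>S \<rightarrow>\<^sub>E ?K. \<Prod>i\<in>S. (B(b := B b * B a)) i $$ (k i, k (q i))))"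
    if q: "q permutes S" and b: "b \<in> S" for q b
  proof -
    have qa: "q a = a" using q S by (simp add: permutes_not_in)
    have qS: "q i \<in> S" if "i \<in> S" for i using that permutes_in_image[OF q] by metis
    have ab: "a \<noteq> b" using b S by auto
    have "(\<Sum>k\<in>insert a S \<rightarrow>\<^sub>E ?K. \<Prod>i\<in>insert a S. B i $$ (k i, k ((q \<circ> Transposition.transpose a b) i))) =
      (\<Sum>k\<in>S \<rightarrow>\<^sub>E ?K. \<Sum>x\<in>?K. B a $$ (x, k (q b)) * (B b $$ (k b, x) *
          (\<Prod>i\<in>S - {b}. B i $$ (k i, k (q i)))))"
      unfolding sum_PiE_insert[OF S(2)]
    proof (intro sum.cong refl)
      fix k :: "'i \<Rightarrow> nat" and x
      let ?k = "k(a := x)" and ?s = "q \<circ> Transposition.transpose a b"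
      have rest: "(\<Prod>i\<in>S - {b}. B i $$ (?k i, ?k (?s i))) = (\<Prod>i\<in>S - {b}. B i $$ (k i, k (q i)))"
        using S qS by (intro prod.cong) (auto simp: Transposition.transpose_def)
      have "(\<Prod>i\<in>insert a S. B i $$ (?k i, ?k (?s i))) = B a $$ (?k a, ?k (?s a)) *
          (B b $$ (?k b, ?k (?s b)) * (\<Prod>i\<in>S - {b}. B i $$ (?k i, ?k (?s i))))"
        by (subst prod.insert[OF S], subst prod.remove[OF S(1) b]) (rule refl)
      also have "?k (?s a) = k (q b)" using qS[OF b] S by auto
      also have "?k (?s b) = x" by (simp add: qa)
      also have "?k b = k b" using ab by simp
      finally show "(\<Prod>i\<in>insert a S. B i $$ (?k i, ?k (?s i))) = B a $$ (x, k (q b)) *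
          (B b $$ (k b, x) * (\<Prod>i\<in>S - {b}. B i $$ (k i, k (q i))))"
        by (simp only: rest fun_upd_same)
    qed
    also have "\<dots> = (\<Sum>k\<in>S \<rightarrow>\<^sub>E ?K. \<Prod>i\<in>S. (B(b := B b * B a)) i $$ (k i, k (q i)))"
    proof (intro sum.cong refl)
      fix k assume k: "k \<in> S \<rightarrow>\<^sub>E ?K"
      have "k b < t" "k (q b) < t" using k b qS[OF b] by (auto dest: PiE_mem)
      then have edge: "(B b * B a) $$ (k b, k (q b)) = (\<Sum>x\<in>?K. B b $$ (k b, x) * B a $$ (x, k (q b)))"
        using B[of a] B[of b] b by (simp add: scalar_prod_def atLeast0LessThan)
      have "(\<Prod>i\<in>S. (B(b := B b * B a)) i $$ (k i, k (q i))) =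
        (B b * B a) $$ (k b, k (q b)) * (\<Prod>i\<in>S - {b}. B i $$ (k i, k (q i)))"
        by (subst prod.remove[OF S(1) b]) simp
      also have "\<dots> = (\<Sum>x\<in>?K. B a $$ (x, k (q b)) * (B b $$ (k b, x) *
          (\<Prod>i\<in>S - {b}. B i $$ (k i, k (q i)))))"
        unfolding edge sum_distrib_right by (intro sum.cong refl) (simp only: mult_ac)
      finally show "(\<Sum>x\<in>?K. B a $$ (x, k (q b)) * (B b $$ (k b, x) *
          (\<Prod>i\<in>S - {b}. B i $$ (k i, k (q i))))) =
        (\<Prod>i\<in>S. (B(b := B b * B a)) i $$ (k i, k (q i)))"
        by (rule sym)
    qed
    moreover have "\<gamma> (q \<circ> Transposition.transpose a b) = \<epsilon> * \<gamma> q"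
      using \<gamma> q S b unfolding cycle_insertion_weight_def by blast
    ultimately show ?thesis
      by (simp add: F_def mult.assoc)
  qed
  have "permutation_walk_sum \<gamma> t B (insert a S) =
      (\<Sum>b\<in>insert a S. \<Sum>q | q permutes S. F (q \<circ> Transposition.transpose a b))"
    unfolding permutation_walk_sum_def F_def[symmetric] by (rule sum_permutes_insert_right[OF S])
  also have "\<dots> = (\<Sum>q | q permutes S. F q) + (\<Sum>b\<in>S. \<Sum>q | q permutes S. F (q \<circ> Transposition.transpose a b))"
    using S by simp
  also have "\<dots> = mat_trace (B a) * permutation_walk_sum \<gamma> t B S
           + \<epsilon> * (\<Sum>b\<in>S. permutation_walk_sum \<gamma> t (B(b := B b * B a)) S)"
    using fixed spliced unfolding permutation_walk_sum_def by (simp add: sum_distrib_left)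
  finally show ?thesis .
qed

text \<open>The first claim alone does not support an induction, since removing a point leaves a matrix
  \<open>M * M\<close> behind at another point. The second claim admits an arbitrary matrix \<open>N\<close> at one
  point \<open>a\<close>; the \<open>j\<close>-th summand belongs to the permutations in which the cycle of \<open>a\<close> has \<open>j\<close>
  further points, for which there are \<open>fact n / fact (n - j)\<close> ordered choices. Each claim for
  \<open>n\<close> points feeds the other: \<open>N = M\<close> in the second claim is the first claim for \<open>Suc n\<close> points.\<close>
lemma permutation_walk_sum_trace_recursion:
  fixes M :: "'r::field_char_0 mat" and c :: "nat \<Rightarrow> 'r"
  assumes \<gamma>: "cycle_insertion_weight \<epsilon> \<gamma>"
    and M: "M \<in> carrier_mat t t"
    and c0: "c 0 = 1"
    and cSuc: "\<And>n. c (Suc n) =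
      (\<Sum>j\<le>n. \<epsilon> ^ j * (fact n / fact (n - j)) * mat_trace (M ^\<^sub>m Suc j) * c (n - j))"
    and S: "finite S" "card S = n"
  shows "permutation_walk_sum \<gamma> t (\<lambda>_. M) S = c n"
    and "\<And>a N. a \<notin> S \<Longrightarrow> N \<in> carrier_mat t t \<Longrightarrow>
      permutation_walk_sum \<gamma> t ((\<lambda>_. M)(a := N)) (insert a S) =
      (\<Sum>j\<le>n. \<epsilon> ^ j * (fact n / fact (n - j)) * mat_trace (M ^\<^sub>m j * N) * c (n - j))"
  using S
proof (induction n arbitrary: S)
  case 0
  {
    case 1
    then show ?case using \<gamma> c0 by (simp add: permutation_walk_sum_def cycle_insertion_weight_def)
  next
    case (2 a N)
    then have "S = {}" by simp
    then show ?case
      using 2 M \<gamma> c0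
        permutation_walk_sum_insert[OF \<gamma>, of "{}" a "(\<lambda>_. M)(a := N)" t]
      by (simp add: permutation_walk_sum_def[of _ _ _ "{}"] cycle_insertion_weight_def fun_upd_def)
  }
next
  case (Suc n)
  have whole: "permutation_walk_sum \<gamma> t (\<lambda>_. M) S = c (Suc n)"
    if S: "finite S" "card S = Suc n" for S
  proof -
    obtain a S' where S': "S = insert a S'" "a \<notin> S'" "card S' = n" "finite S'"
      using S by (metis card_Suc_eq finite_insert)
    have "(\<lambda>_. M)(a := M) = (\<lambda>_. M)" by auto
    then show ?thesis
      using Suc.IH(2)[OF S'(2) M S'(4,3)] unfolding S'(1) cSuc by simp
  qed
  {
    case 1
    then show ?case by (rule whole)
  next
    case (2 a N)
    \<comment> \<open>As \<open>b\<close> lies in \<open>S\<close> and \<open>a\<close> does not, the altered point is now \<open>b\<close>, with \<open>card (S - {b}) = n\<close>.\<close>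
    have splice: "permutation_walk_sum \<gamma> t (((\<lambda>_. M)(a := N))(b := M * N)) S =
      (\<Sum>j\<le>n. \<epsilon> ^ j * (fact n / fact (n - j)) * mat_trace (M ^\<^sub>m Suc j * N) * c (n - j))"
      if b: "b \<in> S" for b
    proof -
      have "permutation_walk_sum \<gamma> t (((\<lambda>_. M)(a := N))(b := M * N)) S =
        permutation_walk_sum \<gamma> t ((\<lambda>_. M)(b := M * N)) (insert b (S - {b}))"
        using b 2 by (subst insert_Diff[OF b]) (auto intro!: permutation_walk_sum_cong)
      also have "\<dots> = (\<Sum>j\<le>n. \<epsilon> ^ j * (fact n / fact (n - j)) * mat_trace (M ^\<^sub>m j * (M * N)) * c (n - j))"
        using b 2 M by (intro Suc.IH(2)) auto
      also have "\<dots> = (\<Sum>j\<le>n. \<epsilon> ^ j * (fact n / fact (n - j)) * mat_trace (M ^\<^sub>m Suc j * N) * c (n - j))"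
        using M 2 by (simp add: assoc_mult_mat[of _ t t _ t _ t, OF pow_carrier_mat[OF M] M])
      finally show ?thesis .
    qed
    have "permutation_walk_sum \<gamma> t ((\<lambda>_. M)(a := N)) S = permutation_walk_sum \<gamma> t (\<lambda>_. M) S"
      using 2 by (intro permutation_walk_sum_cong) auto
    also have "\<dots> = c (Suc n)" using 2 by (intro whole) auto
    finally have rest: "permutation_walk_sum \<gamma> t ((\<lambda>_. M)(a := N)) S = c (Suc n)" .
    have "permutation_walk_sum \<gamma> t ((\<lambda>_. M)(a := N)) (insert a S) =
        mat_trace N * permutation_walk_sum \<gamma> t ((\<lambda>_. M)(a := N)) S
        + \<epsilon> * (\<Sum>b\<in>S. permutation_walk_sum \<gamma> t (((\<lambda>_. M)(a := N))(b := M * N)) S)"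
    proof -
      have "((\<lambda>_. M)(a := N)) b = M" if "b \<in> S" for b using that 2 by auto
      then show ?thesis
        using permutation_walk_sum_insert[OF \<gamma>, of S a "(\<lambda>_. M)(a := N)" t] 2 M by simp
    qed
    also have "\<dots> = mat_trace N * c (Suc n) + \<epsilon> * (of_nat (Suc n) *
      (\<Sum>j\<le>n. \<epsilon> ^ j * (fact n / fact (n - j)) * mat_trace (M ^\<^sub>m Suc j * N) * c (n - j)))"
      unfolding rest using splice 2 by simp
    also have "\<dots> = mat_trace N * c (Suc n) + (\<Sum>j\<le>n. \<epsilon> ^ Suc j * (fact (Suc n) / fact (n - j)) *
        mat_trace (M ^\<^sub>m Suc j * N) * c (n - j))"
      unfolding sum_distrib_left
      by (intro arg_cong2[where f = "(+)"] sum.cong refl) (simp add: mult_ac del: of_nat_Suc pow_mat.simps)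
    also have "\<dots> = (\<Sum>j\<le>Suc n. \<epsilon> ^ j * (fact (Suc n) / fact (Suc n - j)) *
        mat_trace (M ^\<^sub>m j * N) * c (Suc n - j))"
    proof -
      have "M ^\<^sub>m 0 * N = N" using 2 M by simp
      then show ?thesis
        unfolding sum.atMost_Suc_shift by (simp del: pow_mat.simps fact_Suc power_Suc)
    qed
    finally show ?case .
  }
qed

section \<open>The exponential formula\<close>

text \<open>The coefficients of the differential equation \<open>E' = S' E\<close>, taken for
  \<open>fact n * fps_nth E n\<close> so that they match the recursion of the permutation sums.\<close>
lemma fps_exp_compose_recursion:
  fixes s :: "nat \<Rightarrow> 'r::field_char_0"
  defines "E \<equiv> fps_compose (fps_exp 1) (Abs_fps (\<lambda>k. if k = 0 then 0 else s k / of_nat k))"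
  shows "fps_nth E 0 = 1"
    and "fact (Suc n) * fps_nth E (Suc n) =
      (\<Sum>j\<le>n. fact n / fact (n - j) * s (Suc j) * (fact (n - j) * fps_nth E (n - j)))"
proof -
  let ?S = "Abs_fps (\<lambda>k. if k = 0 then 0 else s k / of_nat k)"
  show "fps_nth E 0 = 1" by (simp add: E_def)
  have "fps_deriv E = fps_deriv ?S * E"
    unfolding E_def by (subst fps_compose_deriv) (simp_all add: mult.commute)
  then have "of_nat (Suc n) * fps_nth E (Suc n) = (\<Sum>j\<le>n. s (Suc j) * fps_nth E (n - j))"
    by (auto simp: fps_eq_iff fps_mult_nth atLeast0AtMost dest!: spec[of _ n] simp del: of_nat_Suc)
  then have "fact (Suc n) * fps_nth E (Suc n) = fact n * (\<Sum>j\<le>n. s (Suc j) * fps_nth E (n - j))"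
    by (simp add: mult_ac)
  then show "fact (Suc n) * fps_nth E (Suc n) =
      (\<Sum>j\<le>n. fact n / fact (n - j) * s (Suc j) * (fact (n - j) * fps_nth E (n - j)))"
    by (simp add: sum_distrib_left mult_ac)
qed

lemma permutation_walk_sum_egf:
  fixes M :: "'r::field_char_0 mat"
  assumes \<gamma>: "cycle_insertion_weight \<epsilon> \<gamma>" and M: "M \<in> carrier_mat t t"
  shows "Abs_fps (\<lambda>n. permutation_walk_sum \<gamma> t (\<lambda>_. M) {0..<n} / fact n) =
    fps_compose (fps_exp 1)
      (Abs_fps (\<lambda>k. if k = 0 then 0 else \<epsilon> ^ (k - 1) * mat_trace (M ^\<^sub>m k) / of_nat k))"
    (is "_ = ?E")
proof (rule fps_ext)
  fix n
  note rec = fps_exp_compose_recursion[where s = "\<lambda>k. \<epsilon> ^ (k - 1) * mat_trace (M ^\<^sub>m k)"]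
  have "permutation_walk_sum \<gamma> t (\<lambda>_. M) {0..<n} = fact n * fps_nth ?E n"
  proof (rule permutation_walk_sum_trace_recursion(1)[OF \<gamma> M, where c = "\<lambda>n. fact n * fps_nth ?E n"])
    show "fact 0 * fps_nth ?E 0 = 1"
      unfolding rec(1) by simp
    show "fact (Suc m) * fps_nth ?E (Suc m) =
      (\<Sum>j\<le>m. \<epsilon> ^ j * (fact m / fact (m - j)) * mat_trace (M ^\<^sub>m Suc j) * (fact (m - j) * fps_nth ?E (m - j)))"
      for m
      unfolding rec(2)[of m] diff_Suc_1 by (intro sum.cong refl) (simp only: mult.assoc mult.left_commute)
  qed simp_all
  then show "fps_nth (Abs_fps (\<lambda>n. permutation_walk_sum \<gamma> t (\<lambda>_. M) {0..<n} / fact n)) n = fps_nth ?E n"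
    by simp
qed

section \<open>Expectations of Gram matrix entries\<close>

text \<open>The integrand is a sum, over labellings \<open>k\<close>, of products in which the \<open>i\<close>-th random vector
  enters only through its components \<open>k i\<close> and \<open>k (\<rho> i)\<close>, where \<open>\<rho>\<close> is the inverse of \<open>\<sigma>\<close>: the
  factors are functions of independent vectors, so both integrability and the value of the
  integral reduce to products of two components of a single vector.\<close>
lemma expectation_gram_permutation_product:
  fixes V :: "nat \<Rightarrow> 'b \<Rightarrow> nat \<Rightarrow> real"
  assumes Q: "prob_space Q"
    and w: "w \<in> measurable P (real_space t)"
    and int: "\<And>i j. i < t \<Longrightarrow> j < t \<Longrightarrow> integrable P (\<lambda>\<omega>. w \<omega> i * w \<omega> j)"
    and indep: "prob_space.indep_vars Q (\<lambda>_. real_space t) V {..<n}"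
    and distr: "\<And>i. i < n \<Longrightarrow> distr Q (real_space t) (V i) = distr P (real_space t) w"
    and \<sigma>: "\<sigma> permutes {0..<n}"
  defines "g \<equiv> (\<lambda>\<omega>. \<Prod>i = 0..<n. gram_mat t n (\<lambda>i. V i \<omega>) $$ (i, \<sigma> i))"
  shows "integrable Q g"
    and "(\<integral>\<omega>. g \<omega> \<partial>Q) =
      (\<Sum>k\<in>{0..<n} \<rightarrow>\<^sub>E {..<t}. \<Prod>i = 0..<n. second_moment_mat P t w $$ (k i, k (\<sigma> i)))"
proof -
  interpret Q: prob_space Q by (rule Q)
  let ?I = "{0..<n}" and ?M = "second_moment_mat P t w"
  define \<rho> where "\<rho> = Hilbert_Choice.inv \<sigma>"
  have \<rho>: "\<rho> permutes ?I" unfolding \<rho>_def by (rule permutes_inv[OF \<sigma>])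
  have \<sigma>I: "\<sigma> i < n" if "i < n" for i using permutes_in_image[OF \<sigma>, of i] that by simp
  have \<rho>I: "\<rho> i < n" if "i < n" for i using permutes_in_image[OF \<rho>, of i] that by simp
  define X where "X k i x = x (k i) * x (k (\<rho> i))" for k :: "nat \<Rightarrow> nat" and i and x :: "nat \<Rightarrow> real"
  have g: "g \<omega> = (\<Sum>k\<in>?I \<rightarrow>\<^sub>E {..<t}. \<Prod>i\<in>?I. X k i (V i \<omega>))" for \<omega>
  proof -
    have "g \<omega> = (\<Prod>i\<in>?I. \<Sum>l\<in>{..<t}. V i \<omega> l * V (\<sigma> i) \<omega> l)"
      unfolding g_def by (intro prod.cong refl) (simp add: gram_mat_index \<sigma>I)
    also have "\<dots> = (\<Sum>k\<in>?I \<rightarrow>\<^sub>E {..<t}. (\<Prod>i\<in>?I. V i \<omega> (k i)) * (\<Prod>i\<in>?I. V (\<sigma> i) \<omega> (k i)))"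
      by (simp add: prod_sum_PiE prod.distrib)
    also have "\<dots> = (\<Sum>k\<in>?I \<rightarrow>\<^sub>E {..<t}. (\<Prod>i\<in>?I. V i \<omega> (k i)) * (\<Prod>i\<in>?I. V i \<omega> (k (\<rho> i))))"
    proof -
      have "(\<Prod>i\<in>?I. V (\<sigma> i) \<omega> (k i)) = (\<Prod>i\<in>?I. V i \<omega> (k (\<rho> i)))" for k
        using prod.permute[OF \<sigma>, of "\<lambda>i. V i \<omega> (k (\<rho> i))"]
        by (simp add: \<rho>_def permutes_inverses[OF \<sigma>] o_def)
      then show ?thesis by simp
    qed
    finally show ?thesis by (simp add: X_def prod.distrib)
  qed
  have X: "integrable Q (\<lambda>\<omega>. \<Prod>i\<in>?I. X k i (V i \<omega>)) \<and>
      (\<integral>\<omega>. (\<Prod>i\<in>?I. X k i (V i \<omega>)) \<partial>Q) = (\<Prod>i\<in>?I. ?M $$ (k i, k (\<sigma> i)))"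
    if k: "k \<in> ?I \<rightarrow>\<^sub>E {..<t}" for k
  proof -
    have kt: "k i < t" if "i < n" for i using k that by (auto dest!: PiE_mem)
    have meas: "X k i \<in> borel_measurable (real_space t)" if "i \<in> ?I" for i
      using that kt \<rho>I unfolding X_def
      by (intro borel_measurable_times measurable_component_singleton) auto
    have V: "V i \<in> measurable Q (real_space t)" if "i \<in> ?I" for i
      using indep that by (auto simp: Q.indep_vars_def)
    have ind: "Q.indep_vars (\<lambda>_. borel) (\<lambda>i \<omega>. X k i (V i \<omega>)) ?I"
      using indep meas unfolding atLeast0LessThan by (rule Q.indep_vars_compose2)
    have intX: "integrable Q (\<lambda>\<omega>. X k i (V i \<omega>))" if i: "i \<in> ?I" for i
    proof -
      have "integrable P (\<lambda>\<omega>. X k i (w \<omega>))"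
        unfolding X_def using i by (intro int kt \<rho>I) auto
      then have "integrable (distr Q (real_space t) (V i)) (X k i)"
        using w meas[OF i] distr[of i] i by (simp add: integrable_distr_eq)
      then show ?thesis using V[OF i] meas[OF i] by (simp add: integrable_distr_eq)
    qed
    have valX: "(\<integral>\<omega>. X k i (V i \<omega>) \<partial>Q) = ?M $$ (k i, k (\<rho> i))" if i: "i \<in> ?I" for i
    proof -
      have "(\<integral>\<omega>. X k i (V i \<omega>) \<partial>Q) = (\<integral>x. X k i x \<partial>distr Q (real_space t) (V i))"
        using V[OF i] meas[OF i] by (simp add: integral_distr)
      also have "\<dots> = (\<integral>\<omega>. X k i (w \<omega>) \<partial>P)"
        using w meas[OF i] distr[of i] i by (simp add: integral_distr)
      finally show ?thesis
        using i kt \<rho>I by (simp add: X_def second_moment_mat_def)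
    qed
    \<comment> \<open>The inverse permutation disappears by reindexing, at the price of transposing \<open>?M\<close>, which is
      symmetric.\<close>
    have "(\<Prod>i\<in>?I. ?M $$ (k i, k (\<rho> i))) = (\<Prod>i\<in>?I. ?M $$ (k (\<sigma> i), k i))"
      using prod.permute[OF \<sigma>, of "\<lambda>i. ?M $$ (k i, k (\<rho> i))"]
      by (simp add: \<rho>_def permutes_inverses[OF \<sigma>] o_def)
    also have "\<dots> = (\<Prod>i\<in>?I. ?M $$ (k i, k (\<sigma> i)))"
      using kt \<sigma>I by (intro prod.cong refl) (simp add: second_moment_mat_def mult.commute)
    finally show ?thesis
      using Q.indep_vars_integrable[OF _ ind intX] Q.indep_vars_lebesgue_integral[OF _ ind intX] valX
      by simp
  qed
  show "integrable Q g" unfolding g using X by (intro Bochner_Integration.integrable_sum) blast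
  show "(\<integral>\<omega>. g \<omega> \<partial>Q) = (\<Sum>k\<in>?I \<rightarrow>\<^sub>E {..<t}. \<Prod>i\<in>?I. ?M $$ (k i, k (\<sigma> i)))"
    unfolding g using X by (subst Bochner_Integration.integral_sum) auto
qed

lemma expectation_gram_permutation_sum:
  fixes V :: "nat \<Rightarrow> 'b \<Rightarrow> nat \<Rightarrow> real"
  assumes "prob_space Q"
    and "w \<in> measurable P (real_space t)"
    and "\<And>i j. i < t \<Longrightarrow> j < t \<Longrightarrow> integrable P (\<lambda>\<omega>. w \<omega> i * w \<omega> j)"
    and "prob_space.indep_vars Q (\<lambda>_. real_space t) V {..<n}"
    and "\<And>i. i < n \<Longrightarrow> distr Q (real_space t) (V i) = distr P (real_space t) w"
  shows "(\<integral>\<omega>. (\<Sum>\<sigma> | \<sigma> permutes {0..<n}.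
        \<gamma> \<sigma> * (\<Prod>i = 0..<n. gram_mat t n (\<lambda>i. V i \<omega>) $$ (i, \<sigma> i))) \<partial>Q) =
      permutation_walk_sum \<gamma> t (\<lambda>_. second_moment_mat P t w) {0..<n}"
proof -
  note E = expectation_gram_permutation_product[OF assms]
  show ?thesis
    unfolding permutation_walk_sum_def
    by (subst Bochner_Integration.integral_sum) (auto intro!: E(1) sum.cong simp: E(2))
qed


theorem theorem1:
  fixes t :: nat
    and P :: "'a measure" and w :: "'a \<Rightarrow> nat \<Rightarrow> real"
    and Q :: "nat \<Rightarrow> 'b measure" and W :: "nat \<Rightarrow> nat \<Rightarrow> 'b \<Rightarrow> nat \<Rightarrow> real"
    and M :: "real mat" and G :: "nat \<Rightarrow> 'b \<Rightarrow> real mat"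
    and a p \<tau> :: "nat \<Rightarrow> real"
  assumes "t \<ge> 1"
    and "prob_space P"
    and "w \<in> measurable P (real_space t)"
    and "\<And>i j. i < t \<Longrightarrow> j < t \<Longrightarrow> integrable P (\<lambda>\<omega>. w \<omega> i * w \<omega> j)"
    and "\<And>n. prob_space (Q n)"
    and "\<And>n. prob_space.indep_vars (Q n) (\<lambda>_. real_space t) (W n) {..<n}"
    and "\<And>n i. i < n \<Longrightarrow> distr (Q n) (real_space t) (W n i) = distr P (real_space t) w"
  defines "M \<equiv> second_moment_mat P t w"
    and "G \<equiv> (\<lambda>n \<omega>. gram_mat t n (\<lambda>i. W n i \<omega>))"
    and "a \<equiv> (\<lambda>n. \<integral>\<omega>. Determinant.det (G n \<omega>) \<partial>Q n)"
    and "p \<equiv> (\<lambda>n. \<integral>\<omega>. permanent (G n \<omega>) \<partial>Q n)"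
    and "\<tau> \<equiv> (\<lambda>n. mat_trace (pow_mat M n))"
  shows "Abs_fps (\<lambda>n. a n / fact n) =
           fps_compose (fps_exp 1)
             (Abs_fps (\<lambda>k. if k = 0 then 0 else (-1) ^ (k - 1) * \<tau> k / of_nat k))
       \<and> Abs_fps (\<lambda>n. p n / fact n) =
           fps_compose (fps_exp 1) (Abs_fps (\<lambda>k. if k = 0 then 0 else \<tau> k / of_nat k))"
proof -
  have M: "M \<in> carrier_mat t t"
    unfolding M_def second_moment_mat_def by simp
  note E = expectation_gram_permutation_sum[OF assms(5,3,4,6,7)]
  have a: "a n = permutation_walk_sum (\<lambda>\<sigma>. of_int (sign \<sigma>)) t (\<lambda>_. M) {0..<n}" for n
    unfolding a_def G_def M_def det_def'[OF gram_mat_carrier] by (rule E)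
  have p: "p n = permutation_walk_sum (\<lambda>_. 1) t (\<lambda>_. M) {0..<n}" for n
  proof -
    have dim: "dim_row (gram_mat t n v) = n" for v
      using gram_mat_carrier by (rule carrier_matD)
    show ?thesis
      unfolding p_def G_def M_def permanent_def dim using E[of _ "\<lambda>_. 1"] by simp
  qed
  show ?thesis
    unfolding a p \<tau>_def permutation_walk_sum_egf[OF cycle_insertion_weight_sign M]
      permutation_walk_sum_egf[OF cycle_insertion_weight_one M] power_one mult_1
    by (intro conjI refl)
qed

end
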